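(* Let $r,s$ be positive integers and $G=\mathbb{Z}_2^r\times\mathbb{Z}_4^s$. Then \[\mathcal{G}(G)\cong K_1+\bigl(2^s(2^r-1)K_1\cup(2^s-1)(K_1+2^{r+s-1}K_2)\bigr).\]
   Context: For a finite group $G$, the power graph $\mathcal{G}(G)$ is the simple graph with vertex set $G$ in which two distinct vertices are adjacent if and only if one is a power of the other. $\mathbb{Z}_k^t$ denotes the direct product of $t$ copies of the cyclic group $\mathbb{Z}_k$. $K_t$ is the complete graph on $t$ vertices; $\Gamma\cup\Gamma'$ is the disjoint union; $k\Gamma$ is the disjoint union of $k$ copies of $\Gamma$; the join $\Gamma+\Gamma'$ of disjoint graphs is their disjoint union together with all edges joining a vertex of $\Gamma$ to a vertex of $\Gamma'$. *)

theory Defs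
  imports
    "HOL-Algebra.Elementary_Groups"
    "HOL-Algebra.Product_Groups"
    "Graph_Theory.Graph_Theory"
begin

text \<open>
  Simple graphs are the \<^locale>\<open>pair_graph\<close>s of the Graph Theory entry: an undirected edge
  between \<open>u\<close> and \<open>v\<close> is the pair of opposite arcs \<open>(u, v)\<close>, \<open>(v, u)\<close>.
\<close>

text \<open>
  Exponents are natural numbers; in a finite group these yield the same powers
  as integer (or positive) exponents.
\<close>
definition power_graph :: "('a, 'm) monoid_scheme \<Rightarrow> 'a pair_pre_digraph" where
  "power_graph G = \<lparr> pverts = carrier G,
     parcs = {(x, y). x \<in> carrier G \<and> y \<in> carrier G \<and> x \<noteq> y \<and>
       ((\<exists>n::nat. y = x [^]\<^bsub>G\<^esub> n) \<or> (\<exists>n::nat. x = y [^]\<^bsub>G\<^esub> n))} \<rparr>"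

definition complete_graph :: "nat \<Rightarrow> nat pair_pre_digraph" where
  "complete_graph t = \<lparr> pverts = {..<t}, parcs = {(u, v). u < t \<and> v < t \<and> u \<noteq> v} \<rparr>"

definition graph_union ::
    "'a pair_pre_digraph \<Rightarrow> 'b pair_pre_digraph \<Rightarrow> ('a + 'b) pair_pre_digraph" where
  "graph_union G H = \<lparr> pverts = pverts G <+> pverts H,
     parcs = {(Inl u, Inl v) | u v. (u, v) \<in> parcs G} \<union> {(Inr u, Inr v) | u v. (u, v) \<in> parcs H} \<rparr>"

definition graph_copies :: "nat \<Rightarrow> 'a pair_pre_digraph \<Rightarrow> (nat \<times> 'a) pair_pre_digraph" where
  "graph_copies k G = \<lparr> pverts = {..<k} \<times> pverts G,
     parcs = {((i, u), (i, v)) | i u v. i < k \<and> (u, v) \<in> parcs G} \<rparr>"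

definition graph_join ::
    "'a pair_pre_digraph \<Rightarrow> 'b pair_pre_digraph \<Rightarrow> ('a + 'b) pair_pre_digraph" where
  "graph_join G H = \<lparr> pverts = pverts (graph_union G H),
     parcs = parcs (graph_union G H) \<union>
       {(Inl u, Inr v) | u v. u \<in> pverts G \<and> v \<in> pverts H} \<union>
       {(Inr v, Inl u) | u v. u \<in> pverts G \<and> v \<in> pverts H} \<rparr>"

definition cyclic_power :: "nat \<Rightarrow> nat \<Rightarrow> (nat \<Rightarrow> int) monoid" where
  "cyclic_power k t = product_group {..<t} (\<lambda>_. integer_mod_group k)"

lemma pair_graphI:
  assumes "finite (pverts G)" "parcs G \<subseteq> pverts G \<times> pverts G"
    and "\<And>u v. (u, v) \<in> parcs G \<Longrightarrow> u \<noteq> v \<and> (v, u) \<in> parcs G"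
  shows "pair_graph G"
proof -
  have "finite (parcs G)"
    using assms(1,2) by (meson finite_SigmaI finite_subset)
  then show ?thesis
    using assms by unfold_locales (auto simp: symmetric_def intro!: symI)
qed

lemma pair_graphD:
  assumes "pair_graph G"
  shows "finite (pverts G)" "(u, v) \<in> parcs G \<Longrightarrow> u \<in> pverts G \<and> v \<in> pverts G"
    "(u, v) \<in> parcs G \<Longrightarrow> u \<noteq> v" "(u, v) \<in> parcs G \<Longrightarrow> (v, u) \<in> parcs G"
proof -
  interpret pair_graph G by fact
  show "finite (pverts G)" by (rule pair_finite_verts)
  show "(u, v) \<in> parcs G \<Longrightarrow> u \<in> pverts G \<and> v \<in> pverts G"
    by (blast dest: in_arcsD1 in_arcsD2)
  show "(u, v) \<in> parcs G \<Longrightarrow> u \<noteq> v" using pair_no_loops by fastforce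
  show "(u, v) \<in> parcs G \<Longrightarrow> (v, u) \<in> parcs G"
    using pair_sym_arcs by (auto simp: symmetric_def dest: symD)
qed

lemma pair_graph_power_graph: "finite (carrier G) \<Longrightarrow> pair_graph (power_graph G)"
  by (rule pair_graphI) (auto simp: power_graph_def)

lemma complete_digraph_complete_graph: "complete_digraph t (with_proj (complete_graph t))"
  unfolding complete_digraph_pair_def by (auto simp: complete_graph_def)

lemma pair_graph_graph_union:
  assumes "pair_graph G" "pair_graph H"
  shows "pair_graph (graph_union G H)"
  by (rule pair_graphI) (auto simp: graph_union_def dest: assms[THEN pair_graphD(2)]
    assms[THEN pair_graphD(3)] assms[THEN pair_graphD(4)] intro: assms[THEN pair_graphD(1)])

lemma pair_graph_graph_copies:
  assumes "pair_graph G"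
  shows "pair_graph (graph_copies k G)"
  by (rule pair_graphI) (auto simp: graph_copies_def dest: assms[THEN pair_graphD(2)]
    assms[THEN pair_graphD(3)] assms[THEN pair_graphD(4)] intro: assms[THEN pair_graphD(1)])

lemma pair_graph_graph_join:
  assumes "pair_graph G" "pair_graph H"
  shows "pair_graph (graph_join G H)"
  by (rule pair_graphI) (auto simp: graph_join_def graph_union_def dest: assms[THEN pair_graphD(2)]
    assms[THEN pair_graphD(3)] assms[THEN pair_graphD(4)] intro: assms[THEN pair_graphD(1)])

end

theory Submission
  imports Defs
begin

text \<open>
  In a group of exponent 4, distinct non-identity elements are adjacent in the power graph iff one
  is the square of the other or they are mutually inverse of order 4. Deleting the identity thus
  leaves the involutions that are not squares as isolated vertices, while each involution \<open>q\<close> that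
  is a square is joined to all of its square roots, which are matched up by \<open>x \<mapsto> x\<inverse>\<close>.
  In \<open>\<int>\<^sub>2\<^sup>r \<times> \<int>\<^sub>4\<^sup>s\<close> the squares are the \<open>2\<^sup>s\<close> elements \<open>(0, y)\<close> with all entries of \<open>y\<close> in
  \<open>{0, 2}\<close>, and every square has \<open>2\<^bsup>r+s\<^esup>\<close> square roots.
\<close>

section \<open>Graph isomorphisms, and adjacency in joins, unions and copies\<close>

lemma digraph_iso_with_projI:
  assumes "\<And>u v. (u, v) \<in> parcs G \<Longrightarrow> u \<in> pverts G \<and> v \<in> pverts G"
    and "\<And>u v. (u, v) \<in> parcs H \<Longrightarrow> u \<in> pverts H \<and> v \<in> pverts H"
    and bij: "bij_betw h (pverts G) (pverts H)"
    and arcs: "\<And>u v. u \<in> pverts G \<Longrightarrow> v \<in> pverts G \<Longrightarrow> (h u, h v) \<in> parcs H \<longleftrightarrow> (u, v) \<in> parcs G"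
  shows "digraph_iso (with_proj G) (with_proj H)"
proof -
  \<comment> \<open>An isomorphism of digraphs must also act on arcs. The arcs of
    \<open>with_proj\<close> are ordered pairs with tail \<open>fst\<close> and head
    \<open>snd\<close>, so the vertex map \<open>h\<close> dictates the arc map.\<close>
  define f where
    "f = \<lparr>iso_verts = h, iso_arcs = map_prod h h, iso_head = snd, iso_tail = fst\<rparr>"
  have inj: "inj_on h (pverts G)" and img: "h ` pverts G = pverts H"
    using bij by (auto simp: bij_betw_def)
  have "wf_digraph (with_proj G)"
    by unfold_locales (use assms(1) in auto)
  moreover have "inj_on (map_prod h h) (parcs G)"
    by (rule inj_on_subset[OF map_prod_inj_on[OF inj inj]]) (use assms(1) in auto)
  ultimately have "pre_digraph.digraph_isomorphism (with_proj G) f"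
    using inj by (auto simp: pre_digraph.digraph_isomorphism_def f_def)
  moreover have "parcs H = map_prod h h ` parcs G"
  proof (intro subset_antisym subsetI)
    fix p assume "p \<in> parcs H"
    moreover obtain a b where "p = (a, b)" by (cases p)
    ultimately obtain u v where "u \<in> pverts G" "v \<in> pverts G" "p = (h u, h v)"
      using assms(2)[of a b] img by blast
    then show "p \<in> map_prod h h ` parcs G"
      using arcs[of u v] \<open>p \<in> parcs H\<close> by (auto intro!: rev_image_eqI[of "(u, v)"])
  qed (use assms(1) arcs in auto)
  then have "with_proj H = app_iso f (with_proj G)"
    by (simp add: with_proj_def app_iso_def f_def img)
  ultimately show ?thesis
    by (auto simp: digraph_iso_def)
qed

lemma pverts_graph_join [simp]: "pverts (graph_join G H) = pverts G <+> pverts H"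
  by (simp add: graph_join_def graph_union_def)

lemma parcs_graph_join [simp]:
  "(Inl u, Inl u') \<in> parcs (graph_join G H) \<longleftrightarrow> (u, u') \<in> parcs G"
  "(Inr v, Inr v') \<in> parcs (graph_join G H) \<longleftrightarrow> (v, v') \<in> parcs H"
  "(Inl u, Inr v) \<in> parcs (graph_join G H) \<longleftrightarrow> u \<in> pverts G \<and> v \<in> pverts H"
  "(Inr v, Inl u) \<in> parcs (graph_join G H) \<longleftrightarrow> u \<in> pverts G \<and> v \<in> pverts H"
  by (auto simp: graph_join_def graph_union_def)

lemma pverts_graph_union [simp]: "pverts (graph_union G H) = pverts G <+> pverts H"
  by (simp add: graph_union_def)

lemma parcs_graph_union [simp]:
  "(Inl u, Inl u') \<in> parcs (graph_union G H) \<longleftrightarrow> (u, u') \<in> parcs G"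
  "(Inr v, Inr v') \<in> parcs (graph_union G H) \<longleftrightarrow> (v, v') \<in> parcs H"
  "(Inl u, Inr v) \<notin> parcs (graph_union G H)"
  "(Inr v, Inl u) \<notin> parcs (graph_union G H)"
  by (auto simp: graph_union_def)

lemma pverts_graph_copies [simp]: "pverts (graph_copies k G) = {..<k} \<times> pverts G"
  by (simp add: graph_copies_def)

lemma parcs_graph_copies [simp]:
  "((i, u), (j, v)) \<in> parcs (graph_copies k G) \<longleftrightarrow> i < k \<and> i = j \<and> (u, v) \<in> parcs G"
  by (auto simp: graph_copies_def)

lemma pverts_complete_graph [simp]: "pverts (complete_graph t) = {..<t}"
  by (simp add: complete_graph_def)

lemma parcs_complete_graph [simp]:
  "(u, v) \<in> parcs (complete_graph t) \<longleftrightarrow> u < t \<and> v < t \<and> u \<noteq> v"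
  by (simp add: complete_graph_def)

lemma pair_graph_complete_graph: "pair_graph (complete_graph t)"
  by (rule pair_graphI) auto

text \<open>Split off one orbit \<open>{a, f a}\<close> at a time. The first coordinate of
  \<open>e\<close> numbers the orbits and the second tells the two members apart, so that orbits
  become copies of the complete graph on two vertices. It is applied to inversion on the square
  roots of an involution.\<close>

lemma involution_pairing:
  assumes "finite S" "card S = 2 * k"
    and "\<And>x. x \<in> S \<Longrightarrow> f x \<in> S \<and> f x \<noteq> x \<and> f (f x) = x"
  shows "\<exists>e. bij_betw e S ({..<k} \<times> {..<2::nat}) \<and>
    (\<forall>x\<in>S. \<forall>y\<in>S. fst (e x) = fst (e y) \<longleftrightarrow> y = x \<or> y = f x)"
  using assms
proof (induction k arbitrary: S)
  case 0
  then show ?case by (simp add: bij_betw_def)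
next
  case (Suc k)
  from Suc.prems(2) obtain a where a: "a \<in> S" by fastforce
  define T where "T = S - {a, f a}"
  have fa: "f a \<in> S" "f a \<noteq> a" "f (f a) = a" using Suc.prems(3)[OF a] by auto
  have S: "S = insert a (insert (f a) T)" and aT: "a \<notin> T" "f a \<notin> T"
    using a fa by (auto simp: T_def)
  have "finite T" "card T = 2 * k"
    using Suc.prems(1,2) a fa by (auto simp: T_def card_Diff_subset)
  moreover have fT: "f x \<in> T \<and> f x \<noteq> x \<and> f (f x) = x" if "x \<in> T" for x
    using Suc.prems(3)[of x] that fa unfolding T_def by (metis Diff_iff insert_iff empty_iff)
  ultimately obtain e where e: "bij_betw e T ({..<k} \<times> {..<2::nat})"
    and fst_e: "\<forall>x\<in>T. \<forall>y\<in>T. fst (e x) = fst (e y) \<longleftrightarrow> y = x \<or> y = f x"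
    using Suc.IH[of T] by blast
  \<comment> \<open>The orbit split off gets the new index \<open>k\<close>; all indices used on
    \<open>T\<close> are below \<open>k\<close>.\<close>
  define e' where "e' = e(a := (k, 0), f a := (k, 1))"
  have e'_T: "e' x = e x" if "x \<in> T" for x
    using that aT by (auto simp: e'_def)
  have e'_a: "e' a = (k, 0)" "e' (f a) = (k, 1)"
    using fa by (auto simp: e'_def)
  have lt: "fst (e x) < k" if "x \<in> T" for x
    using bij_betw_apply[OF e that] by auto
  have "bij_betw e' T ({..<k} \<times> {..<2::nat})"
    using e e'_T by (simp cong: bij_betw_cong)
  moreover have "bij_betw e' {a, f a} {(k, 0), (k, 1)}"
    using e'_a fa by (auto simp: bij_betw_def)
  ultimately have "bij_betw e' (T \<union> {a, f a}) ({..<k} \<times> {..<2::nat} \<union> {(k, 0), (k, 1)})"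
    by (rule bij_betw_combine) auto
  moreover have "T \<union> {a, f a} = S" using S by auto
  moreover have "{..<k} \<times> {..<2::nat} \<union> {(k, 0), (k, 1)} = {..<Suc k} \<times> {..<2}"
    by (auto simp: less_Suc_eq numeral_2_eq_2)
  ultimately have "bij_betw e' S ({..<Suc k} \<times> {..<2})" by simp
  moreover have "\<forall>x\<in>S. \<forall>y\<in>S. fst (e' x) = fst (e' y) \<longleftrightarrow> y = x \<or> y = f x"
    unfolding S using fst_e lt e'_T e'_a aT fa fT
    by (auto dest: less_not_refl2 less_not_refl3)
  ultimately show ?case by blast
qed

section \<open>Power graphs of groups of exponent dividing 4\<close>

context group
begin

lemma nat_pow_4: "x \<in> carrier G \<Longrightarrow> x [^] (4::nat) = x \<otimes> x \<otimes> (x \<otimes> x)"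
  by (simp add: numeral_eq_Suc m_assoc)

text \<open>Exponents count only modulo 4, and the third power is the inverse because one more
  factor \<open>x\<close> gives the identity.\<close>

lemma nat_pow_exponent_4:
  assumes x: "x \<in> carrier G" and "x [^] (4::nat) = \<one>"
  shows "(\<exists>n::nat. y = x [^] n) \<longleftrightarrow> y \<in> {\<one>, x, x \<otimes> x, inv x}"
proof -
  have p3: "x [^] (3::nat) = inv x"
    using assms inv_equality[of "x [^] (3::nat)" x] nat_pow_Suc[of x 3]
    by (simp add: numeral_eq_Suc)
  have p1: "x [^] (1::nat) = x"
    using x by simp
  have p2: "x [^] (2::nat) = x \<otimes> x"
    using x by (simp add: numeral_2_eq_2)
  have "x [^] n \<in> {\<one>, x, x \<otimes> x, inv x}" for n :: nat
  proof -
    have "x [^] n = x [^] (4 * (n div 4) + n mod 4)" by simp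
    also have "\<dots> = x [^] (n mod 4)"
      using assms by (simp only: nat_pow_mult[symmetric] nat_pow_pow[symmetric]) simp
    finally have eq: "x [^] n = x [^] (n mod 4)" .
    have "n mod 4 \<in> {0, 1, 2, 3}" by auto
    then show ?thesis unfolding eq using p2 p3 x by auto
  qed
  moreover have "\<exists>n::nat. y = x [^] n" if "y \<in> {\<one>, x, x \<otimes> x, inv x}"
    using that nat_pow_0[of x] p1 p2 p3 by (metis insert_iff empty_iff)
  ultimately show ?thesis by blast
qed

lemma parcs_power_graph_exponent_4:
  assumes "\<And>z. z \<in> carrier G \<Longrightarrow> z [^] (4::nat) = \<one>"
    and "x \<in> carrier G" "y \<in> carrier G"
  shows "(x, y) \<in> parcs (power_graph G) \<longleftrightarrow>
    x \<noteq> y \<and> (x = \<one> \<or> y = \<one> \<or> y = x \<otimes> x \<or> x = y \<otimes> y \<or> y = inv x)"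
  using assms by (auto simp: power_graph_def nat_pow_exponent_4)

text \<open>Three counts determine the graph: \<open>a\<close> non-square involutions,
  \<open>b\<close> nontrivial squares, and \<open>2 * k\<close> roots of each such square. The
  number of roots is written as an even number because they fall into \<open>k\<close> pairs of
  mutual inverses, one for each edge among them.\<close>

lemma power_graph_exponent_4:
  fixes a b k :: nat
  defines "Q \<equiv> (\<lambda>x. x \<otimes> x) ` carrier G - {\<one>}"
  assumes fin: "finite (carrier G)"
    and exp: "\<And>x. x \<in> carrier G \<Longrightarrow> x [^] (4::nat) = \<one>"
    and card_A: "card {x \<in> carrier G. x \<noteq> \<one> \<and> x \<otimes> x = \<one> \<and> x \<notin> Q} = a"
    and card_Q: "card Q = b"
    and card_roots: "\<And>q. q \<in> Q \<Longrightarrow> card {x \<in> carrier G. x \<otimes> x = q} = 2 * k"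
  shows "digraph_iso (with_proj (power_graph G))
    (with_proj (graph_join (complete_graph 1)
      (graph_union (graph_copies a (complete_graph 1))
        (graph_copies b (graph_join (complete_graph 1) (graph_copies k (complete_graph 2)))))))"
    (is "digraph_iso _ (with_proj ?H)")
proof -
  \<comment> \<open>The identity, \<open>A\<close>, \<open>Q\<close> and \<open>C\<close> partition
    the group. \<open>C\<close> consists of the elements of order 4 and is itself the disjoint union
    of the sets \<open>R q\<close> with \<open>q\<close> in \<open>Q\<close>.\<close>
  define A where "A = {x \<in> carrier G. x \<noteq> \<one> \<and> x \<otimes> x = \<one> \<and> x \<notin> Q}"
  define R where "R q = {x \<in> carrier G. x \<otimes> x = q}" for q
  define C where "C = {x \<in> carrier G. x \<otimes> x \<noteq> \<one>}"
  have finA: "finite A" and finQ: "finite Q" and finR: "finite (R q)" for q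
    using fin by (auto simp: A_def Q_def R_def)
  have sq_sq: "x \<otimes> x \<otimes> (x \<otimes> x) = \<one>" if "x \<in> carrier G" for x
    using exp[OF that] by (simp add: nat_pow_4 that)
  have Q: "x \<in> carrier G" "x \<noteq> \<one>" "x \<otimes> x = \<one>" if "x \<in> Q" for x
    using that sq_sq by (auto simp: Q_def)
  have C_sq: "x \<in> carrier G" "x \<noteq> \<one>" "x \<otimes> x \<in> Q" "x \<in> R (x \<otimes> x)" if "x \<in> C" for x
    using that by (auto simp: C_def Q_def R_def)
  have RQ: "x \<in> C" "x \<otimes> x = q" if "x \<in> R q" "q \<in> Q" for x q
    using that Q(2) by (auto simp: R_def C_def)
  \<comment> \<open>A square is its own inverse, so \<open>x\<close> and \<open>inv x\<close> have
    the same square. Hence inversion preserves every \<open>R q\<close>, and by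
    \<open>inv_eq\<close> it has no fixed point there when \<open>q\<close> is not the
    identity.\<close>
  have inv_sq: "inv x \<otimes> inv x = x \<otimes> x" if "x \<in> carrier G" for x
    using that sq_sq[OF that] by (metis inv_equality inv_mult_group m_closed)
  have inv_eq: "inv x = x \<longleftrightarrow> x \<otimes> x = \<one>" if "x \<in> carrier G" for x
    using that by (metis inv_equality r_inv)
  obtain eA where eA: "bij_betw eA A {..<a}"
    using ex_bij_betw_finite_nat[OF finA] card_A by (auto simp: A_def atLeast0LessThan)
  obtain eQ where eQ: "bij_betw eQ Q {..<b}"
    using ex_bij_betw_finite_nat[OF finQ] card_Q by (auto simp: atLeast0LessThan)
  have "\<exists>e. bij_betw e (R q) ({..<k} \<times> {..<2::nat}) \<and>
    (\<forall>x\<in>R q. \<forall>y\<in>R q. fst (e x) = fst (e y) \<longleftrightarrow> y = x \<or> y = inv x)" if "q \<in> Q" for q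
    by (rule involution_pairing)
      (use finR card_roots[OF that] Q(2)[OF that] in \<open>auto simp: R_def inv_sq inv_eq\<close>)
  then obtain e where e: "\<And>q. q \<in> Q \<Longrightarrow> bij_betw (e q) (R q) ({..<k} \<times> {..<2::nat})"
    and fst_e: "\<And>q x y. q \<in> Q \<Longrightarrow> x \<in> R q \<Longrightarrow> y \<in> R q \<Longrightarrow>
      fst (e q x) = fst (e q y) \<longleftrightarrow> y = x \<or> y = inv x"
    by metis
  \<comment> \<open>The identity goes to the outer single vertex, and elements of \<open>A\<close>
    to isolated vertices. Each \<open>q\<close> in \<open>Q\<close> becomes the hub of the copy
    numbered \<open>eQ q\<close>. On the carrier the last branch meets exactly the elements of
    \<open>C\<close>, which go to the copy of their square at the place given by the
    pairing.\<close>
  define h where "h x =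
    (if x = \<one> then Inl 0 :: nat + nat \<times> nat + nat \<times> (nat + nat \<times> nat)
     else if x \<in> A then Inr (Inl (eA x, 0))
     else if x \<in> Q then Inr (Inr (eQ x, Inl 0))
     else Inr (Inr (eQ (x \<otimes> x), Inr (e (x \<otimes> x) x))))"
    for x :: 'a
  have h_one: "h \<one> = Inl 0" by (simp add: h_def)
  have h_A: "h x = Inr (Inl (eA x, 0))" if "x \<in> A" for x
    using that by (auto simp: h_def A_def)
  have h_Q: "h x = Inr (Inr (eQ x, Inl 0))" if "x \<in> Q" for x
    using that by (auto simp: h_def A_def Q_def)
  have h_C: "h x = Inr (Inr (eQ (x \<otimes> x), Inr (e (x \<otimes> x) x)))" if "x \<in> C" for x
    using that Q(3)[of x] by (auto simp: h_def A_def C_def)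
  note h = h_one h_A h_Q h_C
  have A_carrier: "x \<in> carrier G" "x \<noteq> \<one>" "x \<otimes> x = \<one>" "x \<notin> Q" if "x \<in> A" for x
    using that by (auto simp: A_def)
  have carrier_cases: "x = \<one> \<or> x \<in> A \<or> x \<in> Q \<or> x \<in> C" if "x \<in> carrier G" for x
    using that by (auto simp: A_def C_def)
  have C_notin: "x \<notin> A" "x \<notin> Q" "x \<otimes> x \<noteq> \<one>" if "x \<in> C" for x
    using that Q(3)[of x] by (auto simp: A_def C_def)
  have eA_eq: "eA x = eA y \<longleftrightarrow> x = y" if "x \<in> A" "y \<in> A" for x y
    using that eA by (auto simp: bij_betw_def dest: inj_onD)
  have eQ_eq: "eQ x = eQ y \<longleftrightarrow> x = y" if "x \<in> Q" "y \<in> Q" for x y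
    using that eQ by (auto simp: bij_betw_def dest: inj_onD)
  have e_eq: "e (y \<otimes> y) x = e (y \<otimes> y) y \<longleftrightarrow> x = y"
    if "x \<in> C" "y \<in> C" "x \<otimes> x = y \<otimes> y" for x y
    using that e[of "y \<otimes> y"] C_sq(3,4)[of x] C_sq(3,4)[of y]
    by (auto simp: bij_betw_def dest: inj_onD)
  have ranges: "x \<in> A \<Longrightarrow> eA x < a" "x \<in> Q \<Longrightarrow> eQ x < b"
    "x \<in> C \<Longrightarrow> e (x \<otimes> x) x \<in> {..<k} \<times> {..<2}" for x
    using bij_betw_apply[OF eA] bij_betw_apply[OF eQ] bij_betw_apply[OF e[OF C_sq(3)] C_sq(4)]
    by blast+
  have h_eq: "h x = h y \<longleftrightarrow> x = y" if "x \<in> carrier G" "y \<in> carrier G" for x y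
    using carrier_cases[OF that(1)] carrier_cases[OF that(2)] A_carrier(2)[of x] A_carrier(2)[of y]
      Q(2)[of x] Q(2)[of y] C_sq(2,3)[of x] C_sq(2,3)[of y]
      A_carrier(4)[of y] C_notin(1,2)[of y]
    by (elim disjE) (auto simp: h eA_eq eQ_eq e_eq)
  have h_in: "h x \<in> pverts ?H" if "x \<in> carrier G" for x
    using carrier_cases[OF that] ranges[of x] ranges(2)[of "x \<otimes> x"] C_sq(3)[of x]
    by (elim disjE) (auto simp: h)
  have h_surj: "\<exists>x\<in>carrier G. v = h x" if "v \<in> pverts ?H" for v
  proof -
    from that consider "v = Inl 0"
      | i where "i < a" "v = Inr (Inl (i, 0))"
      | j where "j < b" "v = Inr (Inr (j, Inl 0))"
      | j p where "j < b" "p \<in> {..<k} \<times> {..<2}" "v = Inr (Inr (j, Inr p))"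
      by auto
    then show ?thesis
    proof cases
      case 1
      then show ?thesis using h_one by (metis one_closed)
    next
      case (2 i)
      then obtain x where "x \<in> A" "eA x = i" using eA unfolding bij_betw_def by (metis imageE lessThan_iff)
      then show ?thesis using h_A 2 A_carrier(1) by metis
    next
      case (3 j)
      then obtain x where "x \<in> Q" "eQ x = j" using eQ unfolding bij_betw_def by (metis imageE lessThan_iff)
      then show ?thesis using h_Q 3 Q(1) by metis
    next
      case (4 j p)
      then obtain q where q: "q \<in> Q" "eQ q = j" using eQ unfolding bij_betw_def by (metis imageE lessThan_iff)
      with 4 obtain x where "x \<in> R q" "e q x = p"
        using e[OF q(1)] unfolding bij_betw_def by (metis imageE)
      then show ?thesis using h_C[of x] RQ[of x q] q 4 C_sq(1) by metis
    qed
  qed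
  have arcs: "(h x, h y) \<in> parcs ?H \<longleftrightarrow> (x, y) \<in> parcs (power_graph G)"
    if xy: "x \<in> carrier G" "y \<in> carrier G" for x y
  proof -
    have *: "(x, y) \<in> parcs (power_graph G) \<longleftrightarrow>
      x \<noteq> y \<and> (x = \<one> \<or> y = \<one> \<or> y = x \<otimes> x \<or> x = y \<otimes> y \<or> y = inv x)"
      by (rule parcs_power_graph_exponent_4[OF exp xy])
    have inv_inv_sq: "y = inv x \<Longrightarrow> y \<otimes> y = x \<otimes> x" using xy inv_sq by auto
    have inv_self: "x \<otimes> x = \<one> \<Longrightarrow> inv x = x" using xy inv_eq by auto
    \<comment> \<open>The first four cases cover every pair containing the identity or an element of
      \<open>A\<close>; the others are the combinations of \<open>Q\<close> and
      \<open>C\<close>.\<close>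
    consider "x = \<one>" | "y = \<one>" | "x \<in> A" "y \<noteq> \<one>" | "y \<in> A" "x \<noteq> \<one>"
      | "x \<in> Q" "y \<in> Q" | "x \<in> Q" "y \<in> C" | "x \<in> C" "y \<in> Q" | "x \<in> C" "y \<in> C"
      using carrier_cases[OF xy(1)] carrier_cases[OF xy(2)] by blast
    then show ?thesis
    proof cases
      case 1
      then show ?thesis using * h_in[OF xy(2)] carrier_cases[OF xy(2)] C_sq(2)[of y]
        A_carrier(2)[of y] Q(2)[of y] by (auto simp: h)
    next
      case 2
      then show ?thesis using * h_in[OF xy(1)] carrier_cases[OF xy(1)] C_sq(2)[of x]
        A_carrier(2)[of x] Q(2)[of x] by (auto simp: h)
    next
      \<comment> \<open>An element of \<open>A\<close> is not a square, has trivial square and is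
        its own inverse, so its only neighbour is the identity. The next case is the mirror
        image.\<close>
      case 3
      then have "(h x, h y) \<notin> parcs ?H"
        using carrier_cases[OF xy(2)] by (elim disjE) (simp_all add: h)
      moreover have "x \<noteq> y \<otimes> y" using 3 A_carrier[of x] xy(2) by (auto simp: Q_def)
      moreover have "y \<noteq> x \<otimes> x" "inv x = x" using 3 A_carrier[of x] inv_self by auto
      ultimately show ?thesis using * 3 A_carrier(2)[of x] by metis
    next
      case 4
      then have "(h x, h y) \<notin> parcs ?H"
        using carrier_cases[OF xy(1)] by (elim disjE) (simp_all add: h)
      moreover have "y \<noteq> x \<otimes> x" using 4 A_carrier[of y] xy(1) by (auto simp: Q_def)
      moreover have "x \<noteq> y \<otimes> y" using 4 A_carrier[of y] by auto
      moreover have "y = inv x \<Longrightarrow> x = y" using 4 A_carrier[of y] inv_inv_sq inv_self by metis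
      ultimately show ?thesis using * 4 A_carrier(2)[of y] by metis
    next
      case 5
      then show ?thesis using * Q[of x] Q[of y] inv_self by (auto simp: h eQ_eq)
    next
      \<comment> \<open>A hub and a root are joined only within one copy, that is, if
        \<open>eQ x = eQ (y \<otimes> y)\<close>. As \<open>eQ\<close> is injective on
        \<open>Q\<close>, this says \<open>x = y \<otimes> y\<close>; the other kinds of adjacency
        would identify \<open>y\<close>, of order 4, with an element of smaller order.\<close>
      case 6
      then show ?thesis using * Q[of x] C_sq[of y] C_notin[of y] ranges[of x] ranges[of y] inv_self
        by (auto simp: h eQ_eq)
    next
      case 7
      then show ?thesis using * Q[of y] C_sq[of x] C_notin[of x] ranges[of x] ranges[of y] inv_inv_sq
        by (auto simp: h eQ_eq)
    next
      case 8
      \<comment> \<open>Neither element is the square of the other, since squares are not in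
        \<open>C\<close>. So adjacency means being distinct and mutually inverse. This forces equal
        squares, hence the same copy, where \<open>fst_e\<close> detects the inverse pairs.\<close>
      show ?thesis
      proof (cases "x \<otimes> x = y \<otimes> y")
        case True
        obtain i i' where i: "e (y \<otimes> y) x = (i, i')" by force
        obtain j j' where j: "e (y \<otimes> y) y = (j, j')" by force
        have "i = j \<longleftrightarrow> y = x \<or> y = inv x"
          using fst_e[of "y \<otimes> y" x y] C_sq[of x] C_sq[of y] 8 True i j by auto
        moreover have "(i, i') = (j, j') \<longleftrightarrow> x = y"
          using e_eq[of x y] 8 True i j by auto
        moreover have "i < k" "i' < 2" "j < k" "j' < 2" "eQ (y \<otimes> y) < b"
          using ranges(3)[of x] ranges(3)[of y] ranges(2)[of "y \<otimes> y"] C_sq[of y] 8 True i j by auto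
        ultimately show ?thesis
          using * 8 True C_sq[of x] C_sq[of y] C_notin[of x] C_notin[of y] i j by (auto simp: h)
      next
        case False
        then show ?thesis
          using * 8 C_sq[of x] C_sq[of y] C_notin[of x] C_notin[of y] inv_inv_sq
          by (auto simp: h eQ_eq)
      qed
    qed
  qed
  have "bij_betw h (carrier G) (pverts ?H)"
    by (rule bij_betwI') (use h_eq h_in h_surj in auto)
  moreover have "pair_graph ?H"
    by (intro pair_graph_graph_join pair_graph_graph_union pair_graph_graph_copies
        pair_graph_complete_graph)
  ultimately show ?thesis
    using arcs pair_graphD(2)[OF pair_graph_power_graph[OF fin]]
    by (intro digraph_iso_with_projI[where h = h])
      (auto simp: power_graph_def dest: pair_graphD(2))
qed

end

section \<open>Squares and square roots in powers of cyclic groups of order 2 and 4\<close>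

lemma group_cyclic_power: "group (cyclic_power k t)"
  by (simp add: cyclic_power_def)

lemma carrier_cyclic_power:
  "k > 0 \<Longrightarrow> carrier (cyclic_power k t) = {..<t} \<rightarrow>\<^sub>E {0..<int k}"
  by (simp add: cyclic_power_def carrier_integer_mod_group)

lemma one_cyclic_power: "\<one>\<^bsub>cyclic_power k t\<^esub> = (\<lambda>i\<in>{..<t}. 0)"
  by (simp add: cyclic_power_def)

lemma mult_cyclic_power:
  "x \<otimes>\<^bsub>cyclic_power k t\<^esub> y = (\<lambda>i\<in>{..<t}. (x i + y i) mod int k)"
  by (simp add: cyclic_power_def)

lemma square_cyclic_power_2:
  "x \<in> carrier (cyclic_power 2 t) \<Longrightarrow> x \<otimes>\<^bsub>cyclic_power 2 t\<^esub> x = \<one>\<^bsub>cyclic_power 2 t\<^esub>"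
  by (auto simp: mult_cyclic_power one_cyclic_power)

lemma card_cyclic_power: "k > 0 \<Longrightarrow> card (carrier (cyclic_power k t)) = k ^ t"
  by (simp add: carrier_cyclic_power card_PiE)

text \<open>Doubling modulo 4 yields only 0 and 2 in each coordinate, and halving the coordinates
  provides a root.\<close>

lemma squares_cyclic_power_4:
  "(\<lambda>x. x \<otimes>\<^bsub>cyclic_power 4 t\<^esub> x) ` carrier (cyclic_power 4 t) = {..<t} \<rightarrow>\<^sub>E {0, 2}"
proof (intro subset_antisym subsetI)
  fix y :: "nat \<Rightarrow> int" assume y: "y \<in> {..<t} \<rightarrow>\<^sub>E {0, 2}"
  let ?x = "\<lambda>i\<in>{..<t}. y i div 2"
  have val: "y i = 0 \<or> y i = 2" if "i < t" for i using PiE_mem[OF y, of i] that by auto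
  have "y i div 2 \<in> {0..<4}" if "i < t" for i using val[OF that] by auto
  then have x: "?x \<in> carrier (cyclic_power 4 t)" by (auto simp: carrier_cyclic_power)
  have xx: "?x \<otimes>\<^bsub>cyclic_power 4 t\<^esub> ?x = y"
  proof
    fix i show "(?x \<otimes>\<^bsub>cyclic_power 4 t\<^esub> ?x) i = y i"
      using val[of i] PiE_arb[OF y, of i] by (cases "i < t") (auto simp: mult_cyclic_power)
  qed
  show "y \<in> (\<lambda>x. x \<otimes>\<^bsub>cyclic_power 4 t\<^esub> x) ` carrier (cyclic_power 4 t)"
    by (rule image_eqI[where x = ?x]) (simp_all only: x xx)
next
  fix y assume "y \<in> (\<lambda>x. x \<otimes>\<^bsub>cyclic_power 4 t\<^esub> x) ` carrier (cyclic_power 4 t)"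
  then obtain x where "y = (\<lambda>i\<in>{..<t}. (x i + x i) mod 4)" by (auto simp: mult_cyclic_power)
  moreover have "(z + z) mod 4 = 0 \<or> (z + z) mod 4 = 2" for z :: int by presburger
  ultimately show "y \<in> {..<t} \<rightarrow>\<^sub>E {0, 2}" by (simp add: PiE_iff)
qed

text \<open>Roots are chosen independently in each coordinate: 0 is doubled from 0 and 2, and 2 from
  1 and 3. Both cases have the form \<open>y i div 2\<close> or \<open>y i div 2 + 2\<close>, which
  turns the set of roots into a product of two-element sets.\<close>

lemma roots_cyclic_power_4:
  assumes "y \<in> {..<t} \<rightarrow>\<^sub>E {0, 2}"
  shows "{x \<in> carrier (cyclic_power 4 t). x \<otimes>\<^bsub>cyclic_power 4 t\<^esub> x = y} =
    (\<Pi>\<^sub>E i\<in>{..<t}. {y i div 2, y i div 2 + 2})"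
proof -
  have val: "y i = 0 \<or> y i = 2" if "i < t" for i using PiE_mem[OF assms, of i] that by auto
  have mod4_0: "0 \<le> z \<and> z < 4 \<and> (z + z) mod 4 = 0 \<longleftrightarrow> z = 0 \<or> z = 2"
    and mod4_2: "0 \<le> z \<and> z < 4 \<and> (z + z) mod 4 = 2 \<longleftrightarrow> z = 1 \<or> z = 3" for z :: int
    by presburger+
  have iff: "0 \<le> z \<and> z < 4 \<and> (z + z) mod 4 = y i \<longleftrightarrow> z = y i div 2 \<or> z = y i div 2 + 2"
    if "i < t" for i and z :: int
    using val[OF that] by (elim disjE; simp only: mod4_0 mod4_2; simp)
  have sq_eq: "x \<otimes>\<^bsub>cyclic_power 4 t\<^esub> x = y \<longleftrightarrow> (\<forall>i<t. (x i + x i) mod 4 = y i)" for x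
    using PiE_arb[OF assms] by (auto simp: mult_cyclic_power fun_eq_iff)
  have "x \<in> carrier (cyclic_power 4 t) \<and> x \<otimes>\<^bsub>cyclic_power 4 t\<^esub> x = y \<longleftrightarrow>
    (\<forall>i<t. 0 \<le> x i \<and> x i < 4 \<and> (x i + x i) mod 4 = y i) \<and> x \<in> extensional {..<t}" for x
    unfolding sq_eq by (auto simp: carrier_cyclic_power PiE_iff)
  also have "\<dots> x \<longleftrightarrow> x \<in> (\<Pi>\<^sub>E i\<in>{..<t}. {y i div 2, y i div 2 + 2})" for x
    by (simp only: iff PiE_iff Ball_def lessThan_iff insert_iff empty_iff simp_thms
        cong: imp_cong)
  finally show ?thesis by blast
qed

lemma card_roots_cyclic_power_4:
  assumes "y \<in> {..<t} \<rightarrow>\<^sub>E {0, 2}"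
  shows "card {x \<in> carrier (cyclic_power 4 t). x \<otimes>\<^bsub>cyclic_power 4 t\<^esub> x = y} = 2 ^ t"
  by (simp add: roots_cyclic_power_4[OF assms] card_PiE numeral_2_eq_2)

section \<open>The three counts for the direct product\<close>

theorem theorem3p11:
  fixes r s :: nat
  assumes "r > 0" and "s > 0"
  shows "digraph_iso
    (with_proj (power_graph (cyclic_power 2 r \<times>\<times> cyclic_power 4 s)))
    (with_proj (graph_join (complete_graph 1)
      (graph_union
        (graph_copies (2 ^ s * (2 ^ r - 1)) (complete_graph 1))
        (graph_copies (2 ^ s - 1)
          (graph_join (complete_graph 1)
            (graph_copies (2 ^ (r + s - 1)) (complete_graph 2)))))))"
proof -
  let ?P = "cyclic_power 2 r" and ?R = "cyclic_power 4 s"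
  let ?G = "?P \<times>\<times> ?R" and ?E = "{..<s} \<rightarrow>\<^sub>E {0, 2::int}"
  interpret P: group ?P by (rule group_cyclic_power)
  interpret R: group ?R by (rule group_cyclic_power)
  interpret G: group ?G by (rule DirProd_group) unfold_locales
  have sq: "(x, y) \<otimes>\<^bsub>?G\<^esub> (x, y) = (\<one>\<^bsub>?P\<^esub>, y \<otimes>\<^bsub>?R\<^esub> y)" if "x \<in> carrier ?P" for x y
    using square_cyclic_power_2[OF that] by simp
  have squares: "(\<lambda>x. x \<otimes>\<^bsub>?G\<^esub> x) ` carrier ?G = {\<one>\<^bsub>?P\<^esub>} \<times> ?E"
    unfolding squares_cyclic_power_4[symmetric]
  proof (intro subset_antisym subsetI)
    fix q assume "q \<in> {\<one>\<^bsub>?P\<^esub>} \<times> (\<lambda>y. y \<otimes>\<^bsub>?R\<^esub> y) ` carrier ?R"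
    then obtain y where "y \<in> carrier ?R" "q = (\<one>\<^bsub>?P\<^esub>, y \<otimes>\<^bsub>?R\<^esub> y)" by blast
    then show "q \<in> (\<lambda>x. x \<otimes>\<^bsub>?G\<^esub> x) ` carrier ?G"
      by (intro image_eqI[where x = "(\<one>\<^bsub>?P\<^esub>, y)"]) auto
  qed (auto simp: sq simp del: mult_DirProd)
  \<comment> \<open>Squaring forgets the first component, so a root of a square has
    \<open>2 ^ r\<close> free choices there and \<open>2 ^ s\<close> in the second
    component.\<close>
  have roots: "card {z \<in> carrier ?G. z \<otimes>\<^bsub>?G\<^esub> z = q} = 2 ^ (r + s)"
    if q: "q \<in> {\<one>\<^bsub>?P\<^esub>} \<times> ?E" for q
  proof -
    obtain y where y: "q = (\<one>\<^bsub>?P\<^esub>, y)" "y \<in> ?E" using q by blast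
    have "{z \<in> carrier ?G. z \<otimes>\<^bsub>?G\<^esub> z = q} =
      carrier ?P \<times> {x \<in> carrier ?R. x \<otimes>\<^bsub>?R\<^esub> x = y}"
      using y(1) by (auto simp: sq simp del: mult_DirProd)
    then show ?thesis
      using y by (simp add: card_cartesian_product card_cyclic_power card_roots_cyclic_power_4 power_add)
  qed
  have one_E: "\<one>\<^bsub>?R\<^esub> \<in> ?E" by (simp add: one_cyclic_power)
  \<comment> \<open>For the zero vector, halving and adding 2 gives the choices 0 and 2 in every
    coordinate. Thus in the second factor the elements with trivial square are exactly the
    squares.\<close>
  have "{x \<in> carrier ?R. x \<otimes>\<^bsub>?R\<^esub> x = \<one>\<^bsub>?R\<^esub>} = ?E"
    unfolding roots_cyclic_power_4[OF one_E] by (rule PiE_cong) (simp add: one_cyclic_power)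
  then have E_sq: "y \<in> carrier ?R \<and> y \<otimes>\<^bsub>?R\<^esub> y = \<one>\<^bsub>?R\<^esub>" if "y \<in> ?E" for y
    using that by blast
  have one: "\<one>\<^bsub>?G\<^esub> \<in> {\<one>\<^bsub>?P\<^esub>} \<times> ?E" using one_E by simp
  have fin: "finite (carrier ?G)"
    by (simp add: carrier_cyclic_power finite_PiE)
  have finE: "finite ({\<one>\<^bsub>?P\<^esub>} \<times> ?E)" and cardE: "card ({\<one>\<^bsub>?P\<^esub>} \<times> ?E) = 2 ^ s"
    by (simp_all add: finite_PiE card_cartesian_product card_PiE numeral_2_eq_2)
  show ?thesis
  proof (rule G.power_graph_exponent_4, unfold squares)
    show "z [^]\<^bsub>?G\<^esub> (4::nat) = \<one>\<^bsub>?G\<^esub>" if "z \<in> carrier ?G" for z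
    proof -
      \<comment> \<open>A fourth power is the square of a square, and squares of elements of
        \<open>?E\<close> are trivial.\<close>
      have "z \<otimes>\<^bsub>?G\<^esub> z \<in> {\<one>\<^bsub>?P\<^esub>} \<times> ?E" using squares that by blast
      then have "(z \<otimes>\<^bsub>?G\<^esub> z) \<otimes>\<^bsub>?G\<^esub> (z \<otimes>\<^bsub>?G\<^esub> z) = \<one>\<^bsub>?G\<^esub>"
        using E_sq by (auto simp: mult_DirProd')
      then show ?thesis by (simp only: G.nat_pow_4[OF that])
    qed
    \<comment> \<open>The identity is a square too, so removing all squares from the
      \<open>2 ^ (r + s)\<close> elements with trivial square leaves the non-square involutions.
      Their number is \<open>2 ^ (r + s) - 2 ^ s\<close>.\<close>
    have "{z \<in> carrier ?G. z \<noteq> \<one>\<^bsub>?G\<^esub> \<and> z \<otimes>\<^bsub>?G\<^esub> z = \<one>\<^bsub>?G\<^esub> \<and>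
        z \<notin> {\<one>\<^bsub>?P\<^esub>} \<times> ?E - {\<one>\<^bsub>?G\<^esub>}} =
      {z \<in> carrier ?G. z \<otimes>\<^bsub>?G\<^esub> z = \<one>\<^bsub>?G\<^esub>} - {\<one>\<^bsub>?P\<^esub>} \<times> ?E"
      using one by blast
    moreover have "{\<one>\<^bsub>?P\<^esub>} \<times> ?E \<subseteq> {z \<in> carrier ?G. z \<otimes>\<^bsub>?G\<^esub> z = \<one>\<^bsub>?G\<^esub>}"
      using E_sq by auto
    ultimately show "card {z \<in> carrier ?G. z \<noteq> \<one>\<^bsub>?G\<^esub> \<and> z \<otimes>\<^bsub>?G\<^esub> z = \<one>\<^bsub>?G\<^esub> \<and>
        z \<notin> {\<one>\<^bsub>?P\<^esub>} \<times> ?E - {\<one>\<^bsub>?G\<^esub>}} = 2 ^ s * (2 ^ r - 1)"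
      using roots[OF one] finE cardE by (simp only: card_Diff_subset) (simp add: power_add algebra_simps)
    show "card ({\<one>\<^bsub>?P\<^esub>} \<times> ?E - {\<one>\<^bsub>?G\<^esub>}) = 2 ^ s - 1"
      using one cardE by (simp only: card_Diff_singleton)
    \<comment> \<open>Since \<open>r + s\<close> is positive, the truncated subtraction in
      \<open>r + s - 1\<close> is genuine and the doubled power is
      \<open>2 ^ (r + s)\<close>.\<close>
    show "card {z \<in> carrier ?G. z \<otimes>\<^bsub>?G\<^esub> z = q} = 2 * 2 ^ (r + s - 1)"
      if "q \<in> {\<one>\<^bsub>?P\<^esub>} \<times> ?E - {\<one>\<^bsub>?G\<^esub>}" for q
      using roots[of q] that assms by (simp flip: power_Suc)
  qed (rule fin)
qed

end
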